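(* Let $\varphi\colon R\to S$ be a homomorphism of commutative rings such that $2$ is a unit in $S$, and let $M$ be an $S$-module. Then the map $$\mathrm{Der}_R(S,M)\longrightarrow\mathrm{Quad}_\varphi(S^2,M),\quad d\longmapsto[(s,t)\mapsto d(s)t-s\,d(t)]$$ together with the inclusion $\mathrm{Quad}_S(S^2,M)\subseteq\mathrm{Quad}_\varphi(S^2,M)$ gives an isomorphism $$\mathrm{Quad}_S(S^2,M)\oplus\mathrm{Der}_R(S,M)\;\cong\;\mathrm{Quad}_\varphi(S^2,M).$$
   Context: For a map $q\colon M\to N$ between abelian groups, its polarisation is $\mathrm{pol}_q(x,y)=q(x+y)-q(x)-q(y)$. For a homomorphism $\varphi\colon R\to S$ of commutative rings and $S$-modules $M,N$, $\mathrm{Quad}_\varphi(M,N)$ denotes the $S$-module (under pointwise operations) of maps $q\colon M\to N$ with $q(sm)=s^2q(m)$ for all $s\in S$, $m\in M$, and with $\mathrm{pol}_q\colon M\times M\to N$ being $R$-bilinear, where $M,N$ are $R$-modules via $\varphi$. One writes $\mathrm{Quad}_S=\mathrm{Quad}_{\mathrm{id}_S}$. $\mathrm{Der}_R(S,M)$ is the $S$-module of $R$-linear derivations $S\to M$. *)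

theory Defs
  imports "Jordan_Normal_Form.Missing_VectorSpace"
begin

text \<open>The notions \<open>module_hom\<close>, \<open>mod_hom\<close> (a linear map between two modules) and
  \<open>direct_sum\<close> are those of the AFP entry VectorSpace, on top of \<open>HOL-Algebra\<close>. Modules are
  records extending rings; the fields \<open>mult\<close> and \<open>one\<close> play no role in a module, and are
  filled with \<open>undefined\<close> below.\<close>

definition ring_module :: "('s, 'm) ring_scheme \<Rightarrow> ('s, 's) module" where
  "ring_module S =
     \<lparr>carrier = carrier S, mult = undefined, one = undefined,
      zero = \<zero>\<^bsub>S\<^esub>, add = (\<lambda>x y. x \<oplus>\<^bsub>S\<^esub> y), smult = (\<lambda>s x. s \<otimes>\<^bsub>S\<^esub> x)\<rparr>"

definition restrict_scalars :: "('r \<Rightarrow> 's) \<Rightarrow> ('s, 'a, 'm) module_scheme \<Rightarrow> ('r, 'a) module" where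
  "restrict_scalars \<phi> M =
     \<lparr>carrier = carrier M, mult = undefined, one = undefined,
      zero = \<zero>\<^bsub>M\<^esub>, add = (\<lambda>x y. x \<oplus>\<^bsub>M\<^esub> y), smult = (\<lambda>r x. \<phi> r \<odot>\<^bsub>M\<^esub> x)\<rparr>"

text \<open>All maps \<open>A \<rightarrow> N\<close> with pointwise operations. As usual in \<open>HOL-Algebra\<close>, a map defined
  on a set \<open>A\<close> is represented by a function that is \<open>undefined\<close> outside of \<open>A\<close>, so that equality
  of maps is equality of functions.\<close>

definition fun_module :: "'a set \<Rightarrow> ('s, 'b, 'm) module_scheme \<Rightarrow> ('s, 'a \<Rightarrow> 'b) module" where
  "fun_module A N =
     \<lparr>carrier = A \<rightarrow>\<^sub>E carrier N, mult = undefined, one = undefined,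
      zero = (\<lambda>x\<in>A. \<zero>\<^bsub>N\<^esub>),
      add = (\<lambda>f g. \<lambda>x\<in>A. f x \<oplus>\<^bsub>N\<^esub> g x),
      smult = (\<lambda>s f. \<lambda>x\<in>A. s \<odot>\<^bsub>N\<^esub> f x)\<rparr>"

definition polarisation ::
  "('a, 'm) ring_scheme \<Rightarrow> ('b, 'n) ring_scheme \<Rightarrow> ('a \<Rightarrow> 'b) \<Rightarrow> 'a \<Rightarrow> 'a \<Rightarrow> 'b" where
  "polarisation M N q x y = q (x \<oplus>\<^bsub>M\<^esub> y) \<ominus>\<^bsub>N\<^esub> q x \<ominus>\<^bsub>N\<^esub> q y"

definition bilinear_map ::
  "('r, 'k) ring_scheme \<Rightarrow> ('r, 'a, 'l) module_scheme \<Rightarrow> ('r, 'b, 'm) module_scheme \<Rightarrow>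
   ('r, 'c, 'n) module_scheme \<Rightarrow> ('a \<Rightarrow> 'b \<Rightarrow> 'c) \<Rightarrow> bool" where
  "bilinear_map R L M N b \<longleftrightarrow>
     (\<forall>x\<in>carrier L. (\<lambda>y. b x y) \<in> module_hom R M N) \<and>
     (\<forall>y\<in>carrier M. (\<lambda>x. b x y) \<in> module_hom R L N)"

definition Quad ::
  "('r, 'k) ring_scheme \<Rightarrow> ('s, 'l) ring_scheme \<Rightarrow> ('r \<Rightarrow> 's) \<Rightarrow>
   ('s, 'a, 'm) module_scheme \<Rightarrow> ('s, 'b, 'n) module_scheme \<Rightarrow> ('s, 'a \<Rightarrow> 'b) module" where
  "Quad R S \<phi> M N = (fun_module (carrier M) N)
     \<lparr>carrier := {q \<in> carrier M \<rightarrow>\<^sub>E carrier N.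
        (\<forall>s\<in>carrier S. \<forall>m\<in>carrier M. q (s \<odot>\<^bsub>M\<^esub> m) = (s [^]\<^bsub>S\<^esub> (2::nat)) \<odot>\<^bsub>N\<^esub> q m) \<and>
        bilinear_map R (restrict_scalars \<phi> M) (restrict_scalars \<phi> M) (restrict_scalars \<phi> N)
          (polarisation M N q)}\<rparr>"

definition Der ::
  "('r, 'k) ring_scheme \<Rightarrow> ('s, 'l) ring_scheme \<Rightarrow> ('r \<Rightarrow> 's) \<Rightarrow>
   ('s, 'a, 'm) module_scheme \<Rightarrow> ('s, 's \<Rightarrow> 'a) module" where
  "Der R S \<phi> M = (fun_module (carrier S) M)
     \<lparr>carrier := {d \<in> carrier S \<rightarrow>\<^sub>E carrier M.
        d \<in> module_hom R (restrict_scalars \<phi> (ring_module S)) (restrict_scalars \<phi> M) \<and>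
        (\<forall>s\<in>carrier S. \<forall>t\<in>carrier S. d (s \<otimes>\<^bsub>S\<^esub> t) = s \<odot>\<^bsub>M\<^esub> d t \<oplus>\<^bsub>M\<^esub> t \<odot>\<^bsub>M\<^esub> d s)}\<rparr>"

definition module_square :: "('s, 'm) ring_scheme \<Rightarrow> ('s, 's \<times> 's) module" where
  "module_square S = direct_sum (ring_module S) (ring_module S)"

definition der_quad ::
  "('s, 'l) ring_scheme \<Rightarrow> ('s, 'a, 'm) module_scheme \<Rightarrow> ('s \<Rightarrow> 'a) \<Rightarrow> 's \<times> 's \<Rightarrow> 'a" where
  "der_quad S M d =
     (\<lambda>(s, t)\<in>carrier (module_square S). t \<odot>\<^bsub>M\<^esub> d s \<ominus>\<^bsub>M\<^esub> s \<odot>\<^bsub>M\<^esub> d t)"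

end

theory Submission
  imports Defs
begin

text \<open>For \<open>q\<close> in \<open>Quad R S \<phi> (module_square S) M\<close> let \<open>B s t\<close> be the polarisation at \<open>(s, 0)\<close> and
  \<open>(0, t)\<close>, so that \<open>q (s, t) = s\<^sup>2 q (1, 0) + t\<^sup>2 q (0, 1) + B s t\<close>. Polarising
  \<open>B (u s) (u t) = u\<^sup>2 B s t\<close> in \<open>u\<close> gives \<open>B (u s) (v t) + B (v s) (u t) = 2 u v B s t\<close>.
  With \<open>c = B 1 1\<close> and \<open>d s = B s 1 - s c\<close>, the instances with \<open>s = t = 1\<close> and with \<open>v = t = 1\<close>
  yield twice the Leibniz rule for \<open>d\<close>. As \<open>2\<close> is a unit, \<open>d\<close> is a derivation; then the second
  instance becomes \<open>B s t = s t c + (t d s - s d t)\<close>, so \<open>q - der_quad S M d\<close> is the binary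
  quadratic form \<open>s\<^sup>2 q (1, 0) + t\<^sup>2 q (0, 1) + s t c\<close>.\<close>

section \<open>Differences and linear combinations in a module\<close>

context module
begin

lemma diff_eq_iff: "\<lbrakk>x \<in> carrier M; y \<in> carrier M; z \<in> carrier M\<rbrakk> \<Longrightarrow> x \<ominus>\<^bsub>M\<^esub> y = z \<longleftrightarrow> x = z \<oplus>\<^bsub>M\<^esub> y"
  by (metis M.add.inv_closed M.add.inv_solve_right a_minus_def)

lemma eq_diff_iff: "\<lbrakk>x \<in> carrier M; y \<in> carrier M; z \<in> carrier M\<rbrakk> \<Longrightarrow> z = x \<ominus>\<^bsub>M\<^esub> y \<longleftrightarrow> z \<oplus>\<^bsub>M\<^esub> y = x"
  by (metis diff_eq_iff)

lemma add_diff: "\<lbrakk>x \<in> carrier M; y \<in> carrier M; z \<in> carrier M\<rbrakk> \<Longrightarrow> x \<oplus>\<^bsub>M\<^esub> (y \<ominus>\<^bsub>M\<^esub> z) = x \<oplus>\<^bsub>M\<^esub> y \<ominus>\<^bsub>M\<^esub> z"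
  by (simp add: a_minus_def M.a_assoc)

lemma diff_add: "\<lbrakk>x \<in> carrier M; y \<in> carrier M; z \<in> carrier M\<rbrakk> \<Longrightarrow> (x \<ominus>\<^bsub>M\<^esub> y) \<oplus>\<^bsub>M\<^esub> z = x \<oplus>\<^bsub>M\<^esub> z \<ominus>\<^bsub>M\<^esub> y"
  by (simp add: a_minus_def M.a_ac)

lemma diff_diff: "\<lbrakk>x \<in> carrier M; y \<in> carrier M; z \<in> carrier M\<rbrakk> \<Longrightarrow> x \<ominus>\<^bsub>M\<^esub> y \<ominus>\<^bsub>M\<^esub> z = x \<ominus>\<^bsub>M\<^esub> (y \<oplus>\<^bsub>M\<^esub> z)"
  by (simp add: a_minus_def M.a_assoc M.minus_add)

lemma diff_of_diff: "\<lbrakk>x \<in> carrier M; y \<in> carrier M; z \<in> carrier M\<rbrakk> \<Longrightarrow> x \<ominus>\<^bsub>M\<^esub> (y \<ominus>\<^bsub>M\<^esub> z) = x \<oplus>\<^bsub>M\<^esub> z \<ominus>\<^bsub>M\<^esub> y"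
  by (simp add: a_minus_def M.a_ac M.minus_add)

lemma smult_diff: "\<lbrakk>a \<in> carrier R; x \<in> carrier M; y \<in> carrier M\<rbrakk> \<Longrightarrow> a \<odot>\<^bsub>M\<^esub> (x \<ominus>\<^bsub>M\<^esub> y) = a \<odot>\<^bsub>M\<^esub> x \<ominus>\<^bsub>M\<^esub> a \<odot>\<^bsub>M\<^esub> y"
  by (simp add: a_minus_def smult_r_distr smult_r_minus)

text \<open>An identity between linear combinations becomes one without subtraction, which the
  associative-commutative normal form decides.\<close>

lemmas module_algebra_simps = diff_eq_iff eq_diff_iff add_diff diff_add diff_diff diff_of_diff
  smult_diff smult_l_distr smult_r_distr smult_assoc_simp M.a_ac R.m_ac R.l_distr R.r_distr

text \<open>Multiply both sides by the inverse of \<open>u\<close>. With \<open>u\<close> equal to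
  \<open>1 + 1\<close> this turns twice the Leibniz rule into the Leibniz rule.\<close>

lemma smult_Units_cancel:
  assumes "u \<in> Units R" "x \<in> carrier M" "y \<in> carrier M" "u \<odot>\<^bsub>M\<^esub> x = u \<odot>\<^bsub>M\<^esub> y"
  shows "x = y"
  by (metis assms R.Units_closed R.Units_inv_closed R.Units_l_inv smult_assoc1 smult_one)

text \<open>The ambient module for both \<open>Quad\<close> and \<open>Der\<close>: each of them has
  the operations of \<open>fun_module\<close> and a smaller carrier, so each needs only a submodule
  argument.\<close>

lemma module_fun_module: "module R (fun_module A M)"
proof (intro moduleI abelian_groupI)
  fix f assume f: "f \<in> carrier (fun_module A M)"
  show "\<exists>g\<in>carrier (fun_module A M). g \<oplus>\<^bsub>fun_module A M\<^esub> f = \<zero>\<^bsub>fun_module A M\<^esub>"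
    by (rule bexI[of _ "\<lambda>x\<in>A. \<ominus>\<^bsub>M\<^esub> f x"])
      (use f in \<open>auto simp: fun_module_def M.l_neg PiE_iff intro!: restrict_ext\<close>)
qed (auto simp: fun_module_def PiE_iff extensional_def R.is_cring M.a_ac smult_l_distr smult_r_distr
    smult_assoc1 fun_eq_iff)

end

section \<open>The modules \<open>S\<close> and \<open>S^2\<close>, and pointwise operations\<close>

lemma module_ring_module:
  assumes "cring S" shows "module S (ring_module S)"
proof -
  interpret cring S by fact
  show ?thesis
  proof (intro moduleI abelian_groupI)
    fix x assume "x \<in> carrier (ring_module S)"
    then show "\<exists>y\<in>carrier (ring_module S). y \<oplus>\<^bsub>ring_module S\<^esub> x = \<zero>\<^bsub>ring_module S\<^esub>"
      by (intro bexI[of _ "\<ominus>\<^bsub>S\<^esub> x"]) (simp_all add: ring_module_def l_neg)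
  qed (auto simp: ring_module_def is_cring a_ac m_assoc l_distr r_distr)
qed

lemma module_module_square: "cring S \<Longrightarrow> module S (module_square S)"
  unfolding module_square_def by (intro direct_sum_is_module module_ring_module)

lemma module_square_simps [simp]:
  "carrier (module_square S) = carrier S \<times> carrier S"
  "x \<oplus>\<^bsub>module_square S\<^esub> y = (fst x \<oplus>\<^bsub>S\<^esub> fst y, snd x \<oplus>\<^bsub>S\<^esub> snd y)"
  "s \<odot>\<^bsub>module_square S\<^esub> x = (s \<otimes>\<^bsub>S\<^esub> fst x, s \<otimes>\<^bsub>S\<^esub> snd x)"
  by (simp_all add: module_square_def direct_sum_def ring_module_def)

lemma fun_module_ops [simp]:
  "\<zero>\<^bsub>fun_module A N\<^esub> = (\<lambda>x\<in>A. \<zero>\<^bsub>N\<^esub>)"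
  "f \<oplus>\<^bsub>fun_module A N\<^esub> g = (\<lambda>x\<in>A. f x \<oplus>\<^bsub>N\<^esub> g x)"
  "s \<odot>\<^bsub>fun_module A N\<^esub> f = (\<lambda>x\<in>A. s \<odot>\<^bsub>N\<^esub> f x)"
  by (simp_all add: fun_module_def)

lemma Quad_ops [simp]:
  "f \<oplus>\<^bsub>Quad R S \<phi> P N\<^esub> g = (\<lambda>x\<in>carrier P. f x \<oplus>\<^bsub>N\<^esub> g x)"
  "s \<odot>\<^bsub>Quad R S \<phi> P N\<^esub> f = (\<lambda>x\<in>carrier P. s \<odot>\<^bsub>N\<^esub> f x)"
  by (simp_all add: Quad_def fun_module_def)

lemma Der_ops [simp]:
  "f \<oplus>\<^bsub>Der R S \<phi> N\<^esub> g = (\<lambda>x\<in>carrier S. f x \<oplus>\<^bsub>N\<^esub> g x)"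
  "s \<odot>\<^bsub>Der R S \<phi> N\<^esub> f = (\<lambda>x\<in>carrier S. s \<odot>\<^bsub>N\<^esub> f x)"
  by (simp_all add: Der_def fun_module_def)

section \<open>Quadratic maps and derivations as \<open>S\<close>-modules\<close>

locale module_over_hom = ring_hom_cring R S \<phi> + M?: module S M
  for R :: "('r, 'k) ring_scheme" and S :: "('s, 'l) ring_scheme" and \<phi> :: "'r \<Rightarrow> 's"
    and M :: "('s, 'a, 'm) module_scheme"
begin

text \<open>The polarisation is symmetric, so linearity in the first argument already gives
  bilinearity.\<close>

lemma Quad_iff:
  assumes "module S P"
  shows "q \<in> carrier (Quad R S \<phi> P M) \<longleftrightarrow>
    q \<in> carrier P \<rightarrow>\<^sub>E carrier M \<and>
    (\<forall>s\<in>carrier S. \<forall>x\<in>carrier P. q (s \<odot>\<^bsub>P\<^esub> x) = (s \<otimes>\<^bsub>S\<^esub> s) \<odot>\<^bsub>M\<^esub> q x) \<and>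
    (\<forall>x\<in>carrier P. \<forall>y\<in>carrier P. \<forall>z\<in>carrier P. polarisation P M q (x \<oplus>\<^bsub>P\<^esub> y) z =
      polarisation P M q x z \<oplus>\<^bsub>M\<^esub> polarisation P M q y z) \<and>
    (\<forall>r\<in>carrier R. \<forall>x\<in>carrier P. \<forall>z\<in>carrier P. polarisation P M q (\<phi> r \<odot>\<^bsub>P\<^esub> x) z =
      \<phi> r \<odot>\<^bsub>M\<^esub> polarisation P M q x z)" (is "_ \<longleftrightarrow> ?fun \<and> ?hom \<and> ?add \<and> ?lin")
proof -
  interpret P: module S P by fact
  have "bilinear_map R (restrict_scalars \<phi> P) (restrict_scalars \<phi> P) (restrict_scalars \<phi> M)
      (polarisation P M q) \<longleftrightarrow> ?add \<and> ?lin" if q: ?fun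
  proof -
    have qc: "q x \<in> carrier M" if "x \<in> carrier P" for x using q that by auto
    have closed: "polarisation P M q x y \<in> carrier M" if "x \<in> carrier P" "y \<in> carrier P" for x y
      using that qc by (simp add: polarisation_def)
    have sym: "polarisation P M q x y = polarisation P M q y x" if "x \<in> carrier P" "y \<in> carrier P" for x y
      using that qc by (simp add: polarisation_def P.a_comm M.module_algebra_simps)
    show ?thesis
      using closed sym
      by (auto simp: bilinear_map_def module_hom_def restrict_scalars_def)
  qed
  then show ?thesis
    by (auto simp: Quad_def numeral_2_eq_2)
qed

text \<open>For fixed arguments the polarisation is \<open>S\<close>-linear in the map that is
  polarised, so the defining conditions are stable under pointwise sums and scalar multiples.
  \<open>Quad\<close> is by definition \<open>fun_module\<close> with its carrier replaced, which is
  how a submodule is regarded as a module.\<close>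

lemma module_Quad:
  assumes P: "module S P"
  shows "module S (Quad R S \<phi> P M)"
proof -
  interpret P: module S P by fact
  interpret F: module S "fun_module (carrier P) M" by (rule M.module_fun_module)
  let ?Q = "carrier (Quad R S \<phi> P M)"
  have "submodule S ?Q (fun_module (carrier P) M)"
  proof (rule LinearCombinations.submodule.intro)
    show "module S (fun_module (carrier P) M)" by (rule F.module_axioms)
    show "?Q \<subseteq> carrier (fun_module (carrier P) M)"
      by (auto simp: Quad_def fun_module_def)
    show "\<zero>\<^bsub>fun_module (carrier P) M\<^esub> \<in> ?Q"
      by (simp add: Quad_iff[OF P] polarisation_def M.module_algebra_simps)
  next
    fix f g assume fg: "f \<in> ?Q" "g \<in> ?Q"
    let ?h = "\<lambda>x\<in>carrier P. f x \<oplus>\<^bsub>M\<^esub> g x"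
    have c: "f x \<in> carrier M" "g x \<in> carrier M" if "x \<in> carrier P" for x
      using fg that by (auto simp: Quad_iff[OF P])
    have pc: "polarisation P M f x y \<in> carrier M" "polarisation P M g x y \<in> carrier M"
      if "x \<in> carrier P" "y \<in> carrier P" for x y
      using that c by (simp_all add: polarisation_def)
    have pol: "polarisation P M ?h x y = polarisation P M f x y \<oplus>\<^bsub>M\<^esub> polarisation P M g x y"
      if "x \<in> carrier P" "y \<in> carrier P" for x y
      using that c by (simp add: polarisation_def M.module_algebra_simps)
    show "f \<oplus>\<^bsub>fun_module (carrier P) M\<^esub> g \<in> ?Q"
      using fg c by (simp add: Quad_iff[OF P] pol pc M.smult_r_distr M.a_ac)
  next
    fix s f assume s: "s \<in> carrier S" and f: "f \<in> ?Q"
    let ?h = "\<lambda>x\<in>carrier P. s \<odot>\<^bsub>M\<^esub> f x"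
    have c: "f x \<in> carrier M" if "x \<in> carrier P" for x
      using f that by (auto simp: Quad_iff[OF P])
    have pc: "polarisation P M f x y \<in> carrier M" if "x \<in> carrier P" "y \<in> carrier P" for x y
      using that c by (simp_all add: polarisation_def)
    have pol: "polarisation P M ?h x y = s \<odot>\<^bsub>M\<^esub> polarisation P M f x y"
      if "x \<in> carrier P" "y \<in> carrier P" for x y
      using that c s by (simp add: polarisation_def M.module_algebra_simps)
    show "s \<odot>\<^bsub>fun_module (carrier P) M\<^esub> f \<in> ?Q"
      using f s c by (simp add: Quad_iff[OF P] pol pc M.module_algebra_simps)
  qed
  from F.submodule_is_module[OF this] show ?thesis
    by (simp add: Quad_def)
qed

lemma Der_iff:
  "d \<in> carrier (Der R S \<phi> M) \<longleftrightarrow> d \<in> carrier S \<rightarrow>\<^sub>E carrier M \<and>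
    (\<forall>s\<in>carrier S. \<forall>t\<in>carrier S. d (s \<oplus>\<^bsub>S\<^esub> t) = d s \<oplus>\<^bsub>M\<^esub> d t) \<and>
    (\<forall>r\<in>carrier R. \<forall>s\<in>carrier S. d (\<phi> r \<otimes>\<^bsub>S\<^esub> s) = \<phi> r \<odot>\<^bsub>M\<^esub> d s) \<and>
    (\<forall>s\<in>carrier S. \<forall>t\<in>carrier S. d (s \<otimes>\<^bsub>S\<^esub> t) = s \<odot>\<^bsub>M\<^esub> d t \<oplus>\<^bsub>M\<^esub> t \<odot>\<^bsub>M\<^esub> d s)"
  by (auto simp: Der_def module_hom_def restrict_scalars_def ring_module_def)

lemma Der_closed: "\<lbrakk>d \<in> carrier (Der R S \<phi> M); s \<in> carrier S\<rbrakk> \<Longrightarrow> d s \<in> carrier M"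
  by (auto simp: Der_iff)

text \<open>The Leibniz rule at \<open>1 * 1\<close> reads \<open>d 1 = d 1 + d 1\<close>.\<close>

lemma Der_one:
  assumes "d \<in> carrier (Der R S \<phi> M)"
  shows "d \<one>\<^bsub>S\<^esub> = \<zero>\<^bsub>M\<^esub>"
proof -
  have "d (\<one>\<^bsub>S\<^esub> \<otimes>\<^bsub>S\<^esub> \<one>\<^bsub>S\<^esub>) = \<one>\<^bsub>S\<^esub> \<odot>\<^bsub>M\<^esub> d \<one>\<^bsub>S\<^esub> \<oplus>\<^bsub>M\<^esub> \<one>\<^bsub>S\<^esub> \<odot>\<^bsub>M\<^esub> d \<one>\<^bsub>S\<^esub>"
    using assms by (simp only: Der_iff S.one_closed)
  then show ?thesis
    using Der_closed[OF assms S.one_closed] by simp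
qed

text \<open>By linearity \<open>d (\<phi> r)\<close> is \<open>\<phi> r\<close> times
  \<open>d 1\<close>, which is zero. Hence the Leibniz rule at a product of \<open>\<phi> r\<close>
  and \<open>s\<close> reduces to linearity over \<open>R\<close>, and the two ways to expand
  \<open>d\<close> there agree.\<close>

lemma Der_scalar:
  assumes "d \<in> carrier (Der R S \<phi> M)" "r \<in> carrier R"
  shows "d (\<phi> r) = \<zero>\<^bsub>M\<^esub>"
proof -
  have "d (\<phi> r \<otimes>\<^bsub>S\<^esub> \<one>\<^bsub>S\<^esub>) = \<phi> r \<odot>\<^bsub>M\<^esub> d \<one>\<^bsub>S\<^esub>"
    using assms unfolding Der_iff by blast
  then show ?thesis
    using assms by (simp add: Der_one)
qed

lemma module_Der: "module S (Der R S \<phi> M)"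
proof -
  interpret F: module S "fun_module (carrier S) M" by (rule M.module_fun_module)
  let ?D = "carrier (Der R S \<phi> M)"
  have "submodule S ?D (fun_module (carrier S) M)"
  proof (rule LinearCombinations.submodule.intro)
    show "module S (fun_module (carrier S) M)" by (rule F.module_axioms)
    show "?D \<subseteq> carrier (fun_module (carrier S) M)"
      by (auto simp: Der_def fun_module_def)
    show "\<zero>\<^bsub>fun_module (carrier S) M\<^esub> \<in> ?D"
      by (simp add: Der_iff)
  next
    fix f g assume fg: "f \<in> ?D" "g \<in> ?D"
    then show "f \<oplus>\<^bsub>fun_module (carrier S) M\<^esub> g \<in> ?D"
      using fg[THEN Der_closed] fg[THEN Der_scalar] by (simp add: Der_iff M.smult_r_distr M.a_ac)
  next
    fix s f assume s: "s \<in> carrier S" and f: "f \<in> ?D"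
    then show "s \<odot>\<^bsub>fun_module (carrier S) M\<^esub> f \<in> ?D"
      using Der_closed[OF f] Der_scalar[OF f] by (simp add: Der_iff M.module_algebra_simps)
  qed
  from F.submodule_is_module[OF this] show ?thesis
    by (simp add: Der_def)
qed

section \<open>The quadratic map attached to a derivation\<close>

text \<open>Replacing \<open>(s, t)\<close> by \<open>(u s, u t)\<close> and applying the Leibniz
  rule produces the terms \<open>u t s (d u)\<close> and \<open>u s t (d u)\<close> with opposite
  signs; what remains is \<open>u^2 (t (d s) - s (d t))\<close>. The polarisation is bilinear over
  \<open>R\<close> because \<open>d\<close> is linear over \<open>R\<close>.\<close>

lemma der_quad_in_Quad:
  assumes d: "d \<in> carrier (Der R S \<phi> M)"
  shows "der_quad S M d \<in> carrier (Quad R S \<phi> (module_square S) M)"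
proof -
  let ?P = "module_square S" and ?q = "der_quad S M d"
  have P: "module S ?P" by (rule module_module_square[OF S.is_cring])
  note c = Der_closed[OF d]
  have dd: "d (s \<oplus>\<^bsub>S\<^esub> t) = d s \<oplus>\<^bsub>M\<^esub> d t" "d (s \<otimes>\<^bsub>S\<^esub> t) = s \<odot>\<^bsub>M\<^esub> d t \<oplus>\<^bsub>M\<^esub> t \<odot>\<^bsub>M\<^esub> d s"
    if "s \<in> carrier S" "t \<in> carrier S" for s t
    using d that unfolding Der_iff by blast+
  have dr: "d (\<phi> r \<otimes>\<^bsub>S\<^esub> s) = \<phi> r \<odot>\<^bsub>M\<^esub> d s" if "r \<in> carrier R" "s \<in> carrier S" for r s
    using d that unfolding Der_iff by blast
  have q: "?q (s, t) = t \<odot>\<^bsub>M\<^esub> d s \<ominus>\<^bsub>M\<^esub> s \<odot>\<^bsub>M\<^esub> d t" if "s \<in> carrier S" "t \<in> carrier S" for s t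
    using that by (simp add: der_quad_def)
  have pol: "polarisation ?P M ?q (s, t) (s', t') =
      (t' \<odot>\<^bsub>M\<^esub> d s \<oplus>\<^bsub>M\<^esub> t \<odot>\<^bsub>M\<^esub> d s') \<ominus>\<^bsub>M\<^esub> (s' \<odot>\<^bsub>M\<^esub> d t \<oplus>\<^bsub>M\<^esub> s \<odot>\<^bsub>M\<^esub> d t')"
    if "s \<in> carrier S" "t \<in> carrier S" "s' \<in> carrier S" "t' \<in> carrier S" for s t s' t'
    using that c by (simp add: polarisation_def q dd(1) M.module_algebra_simps)
  have "?q \<in> carrier ?P \<rightarrow>\<^sub>E carrier M"
    using c by (auto simp: der_quad_def)
  \<comment> \<open>The Leibniz rule \<open>dd(2)\<close> is kept for the second call: in the first
    one it would compete with \<open>dr\<close> at products with \<open>\<phi> r\<close> and could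
    leave terms \<open>d (\<phi> r)\<close>.\<close>
  then show ?thesis
    using c by (simp add: Quad_iff[OF P] q pol dd(1) dr) (simp add: dd(2) M.module_algebra_simps)
qed

lemma mod_hom_der_quad:
  "mod_hom S (Der R S \<phi> M) (Quad R S \<phi> (module_square S) M) (der_quad S M)"
proof (intro mod_hom.intro mod_hom_axioms.intro module_Der module_Quad module_module_square S.is_cring)
  have "der_quad S M \<in> carrier (Der R S \<phi> M) \<rightarrow> carrier (Quad R S \<phi> (module_square S) M)"
    using der_quad_in_Quad by blast
  then show "der_quad S M \<in> module_hom S (Der R S \<phi> M) (Quad R S \<phi> (module_square S) M)"
    unfolding module_hom_def
    by (auto simp: der_quad_def Der_closed M.module_algebra_simps simp del: Pi_iff
        intro!: restrict_ext)
qed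

section \<open>Quadratic maps over \<open>S\<close> inside those over \<open>\<phi>\<close>\<close>

text \<open>Makes every result on \<open>Quad R S \<phi>\<close> available for
  \<open>Quad S S id\<close>.\<close>

lemma module_over_hom_id: "module_over_hom S S id M"
  by (intro module_over_hom.intro ring_hom_cring.intro ring_hom_cring_axioms.intro M.module_axioms S.is_cring id_ring_hom)

text \<open>Homogeneity is the same condition on both sides, and linearity over \<open>S\<close>
  includes linearity for the scalars \<open>\<phi> r\<close>.\<close>

lemma Quad_id_subset:
  assumes P: "module S P"
  shows "carrier (Quad S S id P M) \<subseteq> carrier (Quad R S \<phi> P M)"
  by (auto simp: Quad_iff[OF P] module_over_hom.Quad_iff[OF module_over_hom_id P])

lemma mod_hom_Quad_inclusion:
  assumes P: "module S P"
  shows "mod_hom S (Quad S S id P M) (Quad R S \<phi> P M) (\<lambda>q. q)"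
  using Quad_id_subset[OF P]
  by (intro mod_hom.intro mod_hom_axioms.intro module_Quad P
      module_over_hom.module_Quad[OF module_over_hom_id])
    (auto simp: module_hom_def)

text \<open>Supplies the component in \<open>Quad S S id\<close> of the decomposition below. The
  polarisation is the usual symmetric bilinear form of a binary quadratic form, with each factor 2
  written as a sum of two equal terms.\<close>

lemma binary_form_in_Quad:
  assumes abc: "a \<in> carrier M" "b \<in> carrier M" "c \<in> carrier M"
  shows "(\<lambda>(s, t)\<in>carrier (module_square S).
      (s \<otimes>\<^bsub>S\<^esub> s) \<odot>\<^bsub>M\<^esub> a \<oplus>\<^bsub>M\<^esub> (t \<otimes>\<^bsub>S\<^esub> t) \<odot>\<^bsub>M\<^esub> b \<oplus>\<^bsub>M\<^esub> (s \<otimes>\<^bsub>S\<^esub> t) \<odot>\<^bsub>M\<^esub> c)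
    \<in> carrier (Quad S S id (module_square S) M)" (is "?q \<in> _")
proof -
  let ?P = "module_square S"
  have P: "module S ?P" by (rule module_module_square[OF S.is_cring])
  have q: "?q (s, t) = (s \<otimes>\<^bsub>S\<^esub> s) \<odot>\<^bsub>M\<^esub> a \<oplus>\<^bsub>M\<^esub> (t \<otimes>\<^bsub>S\<^esub> t) \<odot>\<^bsub>M\<^esub> b \<oplus>\<^bsub>M\<^esub> (s \<otimes>\<^bsub>S\<^esub> t) \<odot>\<^bsub>M\<^esub> c"
    if "s \<in> carrier S" "t \<in> carrier S" for s t
    using that by simp
  have PiE: "?q \<in> carrier ?P \<rightarrow>\<^sub>E carrier M"
    using abc by auto
  \<comment> \<open>A name for the form keeps the simplifier from unfolding it before
    \<open>pol\<close> can rewrite its polarisation.\<close>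
  define q where qq: "q = ?q"
  have pol: "polarisation ?P M q (s, t) (s', t') =
      (s \<otimes>\<^bsub>S\<^esub> s' \<oplus>\<^bsub>S\<^esub> s \<otimes>\<^bsub>S\<^esub> s') \<odot>\<^bsub>M\<^esub> a \<oplus>\<^bsub>M\<^esub> (t \<otimes>\<^bsub>S\<^esub> t' \<oplus>\<^bsub>S\<^esub> t \<otimes>\<^bsub>S\<^esub> t') \<odot>\<^bsub>M\<^esub> b
        \<oplus>\<^bsub>M\<^esub> (s \<otimes>\<^bsub>S\<^esub> t' \<oplus>\<^bsub>S\<^esub> s' \<otimes>\<^bsub>S\<^esub> t) \<odot>\<^bsub>M\<^esub> c"
    if "s \<in> carrier S" "t \<in> carrier S" "s' \<in> carrier S" "t' \<in> carrier S" for s t s' t'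
    using that abc by (simp add: polarisation_def q[folded qq] M.module_algebra_simps)
  have "q \<in> carrier (Quad S S id ?P M)"
    using abc PiE[folded qq]
    by (simp add: module_over_hom.Quad_iff[OF module_over_hom_id P] pol q[folded qq])
      (simp add: M.module_algebra_simps)
  then show ?thesis by (simp add: qq)
qed

text \<open>The polarisation of \<open>der_quad S M d\<close> at \<open>(s, 0)\<close> and \<open>(0, 1)\<close> is \<open>d s\<close>. If it is
  \<open>S\<close>-linear in \<open>s\<close>, then \<open>d s = s (d 1) = 0\<close>.\<close>

lemma der_quad_in_Quad_id:
  assumes d: "d \<in> carrier (Der R S \<phi> M)"
    and q: "der_quad S M d \<in> carrier (Quad S S id (module_square S) M)"
  shows "d = (\<lambda>s\<in>carrier S. \<zero>\<^bsub>M\<^esub>)"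
proof -
  let ?P = "module_square S" and ?q = "der_quad S M d"
  have P: "module S ?P" by (rule module_module_square[OF S.is_cring])
  note c = Der_closed[OF d]
  have d0: "d \<zero>\<^bsub>S\<^esub> = \<zero>\<^bsub>M\<^esub>"
  proof -
    have "d (\<zero>\<^bsub>S\<^esub> \<oplus>\<^bsub>S\<^esub> \<zero>\<^bsub>S\<^esub>) = d \<zero>\<^bsub>S\<^esub> \<oplus>\<^bsub>M\<^esub> d \<zero>\<^bsub>S\<^esub>"
      using d by (simp only: Der_iff S.zero_closed)
    then show ?thesis using c[OF S.zero_closed] by simp
  qed
  have pol: "polarisation ?P M ?q (s, \<zero>\<^bsub>S\<^esub>) (\<zero>\<^bsub>S\<^esub>, \<one>\<^bsub>S\<^esub>) = d s" if "s \<in> carrier S" for s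
    using that c[OF that] by (simp add: polarisation_def der_quad_def d0 Der_one[OF d] a_minus_def)
  have lin: "\<forall>r\<in>carrier S. \<forall>x\<in>carrier ?P. \<forall>z\<in>carrier ?P.
      polarisation ?P M ?q (r \<odot>\<^bsub>?P\<^esub> x) z = r \<odot>\<^bsub>M\<^esub> polarisation ?P M ?q x z"
    using q unfolding module_over_hom.Quad_iff[OF module_over_hom_id P] id_apply by blast
  have "d s = \<zero>\<^bsub>M\<^esub>" if s: "s \<in> carrier S" for s
  proof -
    have "polarisation ?P M ?q (s \<odot>\<^bsub>?P\<^esub> (\<one>\<^bsub>S\<^esub>, \<zero>\<^bsub>S\<^esub>)) (\<zero>\<^bsub>S\<^esub>, \<one>\<^bsub>S\<^esub>) =
        s \<odot>\<^bsub>M\<^esub> polarisation ?P M ?q (\<one>\<^bsub>S\<^esub>, \<zero>\<^bsub>S\<^esub>) (\<zero>\<^bsub>S\<^esub>, \<one>\<^bsub>S\<^esub>)"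
      by (rule lin[rule_format]) (simp_all add: s)
    then show ?thesis
      using s by (simp add: pol Der_one[OF d])
  qed
  then show ?thesis
    using d by (auto simp: Der_iff PiE_iff extensional_def)
qed

section \<open>Splitting a quadratic map into a binary form and a derivation\<close>

text \<open>This is surjectivity of the map out of the direct sum.\<close>

lemma Quad_decomposition:
  assumes two: "\<one>\<^bsub>S\<^esub> \<oplus>\<^bsub>S\<^esub> \<one>\<^bsub>S\<^esub> \<in> Units S"
    and q: "q \<in> carrier (Quad R S \<phi> (module_square S) M)"
  shows "\<exists>q0\<in>carrier (Quad S S id (module_square S) M). \<exists>d\<in>carrier (Der R S \<phi> M).
    q = q0 \<oplus>\<^bsub>Quad R S \<phi> (module_square S) M\<^esub> der_quad S M d"
proof -
  let ?P = "module_square S"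
  define p where "p = polarisation ?P M q"
  define B where "B s t = p (s, \<zero>\<^bsub>S\<^esub>) (\<zero>\<^bsub>S\<^esub>, t)" for s t
  have P: "module S ?P" by (rule module_module_square[OF S.is_cring])
  note Q = q[unfolded Quad_iff[OF P], folded p_def]
  have qc: "q (s, t) \<in> carrier M" if "s \<in> carrier S" "t \<in> carrier S" for s t
    using Q that by auto
  have qs: "q (u \<otimes>\<^bsub>S\<^esub> s, u \<otimes>\<^bsub>S\<^esub> t) = (u \<otimes>\<^bsub>S\<^esub> u) \<odot>\<^bsub>M\<^esub> q (s, t)"
    if "u \<in> carrier S" "s \<in> carrier S" "t \<in> carrier S" for u s t
    using Q that by simp
  \<comment> \<open>\<open>Quad_iff\<close> gives additivity in the first argument only; symmetry
    carries it over to the second one in \<open>B_add2\<close>.\<close>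
  have p_sym: "p x y = p y x" if "x \<in> carrier ?P" "y \<in> carrier ?P" for x y
    using that qc by (cases x, cases y) (simp add: p_def polarisation_def S.a_comm M.module_algebra_simps)
  have B: "B s t = q (s, t) \<ominus>\<^bsub>M\<^esub> q (s, \<zero>\<^bsub>S\<^esub>) \<ominus>\<^bsub>M\<^esub> q (\<zero>\<^bsub>S\<^esub>, t)"
    if "s \<in> carrier S" "t \<in> carrier S" for s t
    using that by (simp add: B_def p_def polarisation_def)
  have Bc: "B s t \<in> carrier M" if "s \<in> carrier S" "t \<in> carrier S" for s t
    using that qc by (simp add: B)
  have B_add1: "B (s \<oplus>\<^bsub>S\<^esub> s') t = B s t \<oplus>\<^bsub>M\<^esub> B s' t"
    if "s \<in> carrier S" "s' \<in> carrier S" "t \<in> carrier S" for s s' t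
  proof -
    \<comment> \<open>The sum of pairs must stay unevaluated here in order to match the additivity
      in \<open>Q\<close>; it is computed componentwise only afterwards.\<close>
    have "p ((s, \<zero>\<^bsub>S\<^esub>) \<oplus>\<^bsub>?P\<^esub> (s', \<zero>\<^bsub>S\<^esub>)) (\<zero>\<^bsub>S\<^esub>, t) = p (s, \<zero>\<^bsub>S\<^esub>) (\<zero>\<^bsub>S\<^esub>, t) \<oplus>\<^bsub>M\<^esub> p (s', \<zero>\<^bsub>S\<^esub>) (\<zero>\<^bsub>S\<^esub>, t)"
      using Q that by (simp del: module_square_simps(2,3))
    then show ?thesis by (simp add: B_def)
  qed
  have B_add2: "B s (t \<oplus>\<^bsub>S\<^esub> t') = B s t \<oplus>\<^bsub>M\<^esub> B s t'"
    if "s \<in> carrier S" "t \<in> carrier S" "t' \<in> carrier S" for s t t'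
  proof -
    have "p ((\<zero>\<^bsub>S\<^esub>, t) \<oplus>\<^bsub>?P\<^esub> (\<zero>\<^bsub>S\<^esub>, t')) (s, \<zero>\<^bsub>S\<^esub>) = p (\<zero>\<^bsub>S\<^esub>, t) (s, \<zero>\<^bsub>S\<^esub>) \<oplus>\<^bsub>M\<^esub> p (\<zero>\<^bsub>S\<^esub>, t') (s, \<zero>\<^bsub>S\<^esub>)"
      using Q that by (simp del: module_square_simps(2,3))
    then show ?thesis using that by (simp add: B_def p_sym[of "(s, \<zero>\<^bsub>S\<^esub>)"])
  qed
  have B_lin: "B (\<phi> r \<otimes>\<^bsub>S\<^esub> s) t = \<phi> r \<odot>\<^bsub>M\<^esub> B s t"
    if "r \<in> carrier R" "s \<in> carrier S" "t \<in> carrier S" for r s t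
  proof -
    have "p (\<phi> r \<odot>\<^bsub>?P\<^esub> (s, \<zero>\<^bsub>S\<^esub>)) (\<zero>\<^bsub>S\<^esub>, t) = \<phi> r \<odot>\<^bsub>M\<^esub> p (s, \<zero>\<^bsub>S\<^esub>) (\<zero>\<^bsub>S\<^esub>, t)"
      using Q that by (simp del: module_square_simps(2,3))
    then show ?thesis using that by (simp add: B_def)
  qed
  have B_sq: "B (u \<otimes>\<^bsub>S\<^esub> s) (u \<otimes>\<^bsub>S\<^esub> t) = (u \<otimes>\<^bsub>S\<^esub> u) \<odot>\<^bsub>M\<^esub> B s t"
    if "u \<in> carrier S" "s \<in> carrier S" "t \<in> carrier S" for u s t
    \<comment> \<open>\<open>B s t\<close> is a combination of the values of \<open>q\<close> at
      \<open>(s, t)\<close>, \<open>(s, 0)\<close> and \<open>(0, t)\<close>, and each of them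
      scales by \<open>u^2\<close>.\<close>
    using that qs[of u s t] qs[of u s "\<zero>\<^bsub>S\<^esub>"] qs[of u "\<zero>\<^bsub>S\<^esub>" t] qc
    by (simp add: B M.smult_diff)
  have B_swap: "B (u \<otimes>\<^bsub>S\<^esub> s) (v \<otimes>\<^bsub>S\<^esub> t) \<oplus>\<^bsub>M\<^esub> B (v \<otimes>\<^bsub>S\<^esub> s) (u \<otimes>\<^bsub>S\<^esub> t) =
      (u \<otimes>\<^bsub>S\<^esub> v) \<odot>\<^bsub>M\<^esub> B s t \<oplus>\<^bsub>M\<^esub> (u \<otimes>\<^bsub>S\<^esub> v) \<odot>\<^bsub>M\<^esub> B s t" (is "?x = ?y")
    if c: "u \<in> carrier S" "v \<in> carrier S" "s \<in> carrier S" "t \<in> carrier S" for u v s t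
  proof -
    \<comment> \<open>The diagonal terms of \<open>B ((u + v) s) ((u + v) t)\<close>. Expanding by
      biadditivity leaves the mixed terms \<open>?x\<close>, expanding the square
      \<open>(u + v)^2\<close> leaves \<open>?y\<close>, and \<open>?a\<close> cancels.\<close>
    let ?a = "(u \<otimes>\<^bsub>S\<^esub> u) \<odot>\<^bsub>M\<^esub> B s t \<oplus>\<^bsub>M\<^esub> (v \<otimes>\<^bsub>S\<^esub> v) \<odot>\<^bsub>M\<^esub> B s t"
    have "?a \<oplus>\<^bsub>M\<^esub> ?x = B ((u \<oplus>\<^bsub>S\<^esub> v) \<otimes>\<^bsub>S\<^esub> s) ((u \<oplus>\<^bsub>S\<^esub> v) \<otimes>\<^bsub>S\<^esub> t)"
      using c Bc by (simp add: S.l_distr B_add1 B_add2 B_sq M.a_ac)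
    also have "\<dots> = ?a \<oplus>\<^bsub>M\<^esub> ?y"
      using c Bc by (subst B_sq) (simp_all add: M.module_algebra_simps)
    finally show ?thesis
      using c Bc by simp
  qed
  define c where "c = B \<one>\<^bsub>S\<^esub> \<one>\<^bsub>S\<^esub>"
  define e where "e s = B s \<one>\<^bsub>S\<^esub>" for s
  \<comment> \<open>Since \<open>e 1 = c\<close>, subtracting \<open>s c\<close> makes
    \<open>d\<close> vanish at 1, as a derivation must.\<close>
  define d where "d = (\<lambda>s\<in>carrier S. e s \<ominus>\<^bsub>M\<^esub> s \<odot>\<^bsub>M\<^esub> c)"
  have cc: "c \<in> carrier M" by (simp add: c_def Bc)
  have ec: "e s \<in> carrier M" if "s \<in> carrier S" for s
    using that by (simp add: e_def Bc)
  have B_e: "e (u \<otimes>\<^bsub>S\<^esub> s) \<oplus>\<^bsub>M\<^esub> B s u = u \<odot>\<^bsub>M\<^esub> e s \<oplus>\<^bsub>M\<^esub> u \<odot>\<^bsub>M\<^esub> e s"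
    if "u \<in> carrier S" "s \<in> carrier S" for u s
    using B_swap[of u "\<one>\<^bsub>S\<^esub>" s "\<one>\<^bsub>S\<^esub>"] that by (simp add: e_def)
  have B_c: "B u v \<oplus>\<^bsub>M\<^esub> B v u = (u \<otimes>\<^bsub>S\<^esub> v) \<odot>\<^bsub>M\<^esub> c \<oplus>\<^bsub>M\<^esub> (u \<otimes>\<^bsub>S\<^esub> v) \<odot>\<^bsub>M\<^esub> c"
    if "u \<in> carrier S" "v \<in> carrier S" for u v
    using B_swap[of u v "\<one>\<^bsub>S\<^esub>" "\<one>\<^bsub>S\<^esub>"] that by (simp add: c_def)
  \<comment> \<open>The Leibniz rule for \<open>d\<close>, written in \<open>e\<close> and free of
    subtraction. Its double is the sum of \<open>B_e\<close> for \<open>(u, s)\<close> and for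
    \<open>(s, u)\<close>, after \<open>B_c\<close> has replaced \<open>2 u s c\<close> by
    \<open>B u s + B s u\<close>.\<close>
  have e_mult: "e (u \<otimes>\<^bsub>S\<^esub> s) \<oplus>\<^bsub>M\<^esub> (u \<otimes>\<^bsub>S\<^esub> s) \<odot>\<^bsub>M\<^esub> c = u \<odot>\<^bsub>M\<^esub> e s \<oplus>\<^bsub>M\<^esub> s \<odot>\<^bsub>M\<^esub> e u" (is "?l = ?r")
    if us: "u \<in> carrier S" "s \<in> carrier S" for u s
  proof (rule M.smult_Units_cancel[OF two])
    have "?l \<oplus>\<^bsub>M\<^esub> ?l = (e (u \<otimes>\<^bsub>S\<^esub> s) \<oplus>\<^bsub>M\<^esub> e (u \<otimes>\<^bsub>S\<^esub> s)) \<oplus>\<^bsub>M\<^esub> (B u s \<oplus>\<^bsub>M\<^esub> B s u)"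
      using us ec cc by (subst B_c) (simp_all add: M.a_ac)
    also have "\<dots> = (e (u \<otimes>\<^bsub>S\<^esub> s) \<oplus>\<^bsub>M\<^esub> B s u) \<oplus>\<^bsub>M\<^esub> (e (s \<otimes>\<^bsub>S\<^esub> u) \<oplus>\<^bsub>M\<^esub> B u s)"
      using us ec Bc by (simp add: M.a_ac S.m_comm)
    also have "\<dots> = ?r \<oplus>\<^bsub>M\<^esub> ?r"
      using us ec by (simp add: B_e M.a_ac)
    finally show "(\<one>\<^bsub>S\<^esub> \<oplus>\<^bsub>S\<^esub> \<one>\<^bsub>S\<^esub>) \<odot>\<^bsub>M\<^esub> ?l = (\<one>\<^bsub>S\<^esub> \<oplus>\<^bsub>S\<^esub> \<one>\<^bsub>S\<^esub>) \<odot>\<^bsub>M\<^esub> ?r"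
      using us ec cc by (simp add: M.smult_l_distr)
  qed (use us ec cc in simp_all)
  have e_mult': "e (u \<otimes>\<^bsub>S\<^esub> s) = u \<odot>\<^bsub>M\<^esub> e s \<oplus>\<^bsub>M\<^esub> s \<odot>\<^bsub>M\<^esub> e u \<ominus>\<^bsub>M\<^esub> (u \<otimes>\<^bsub>S\<^esub> s) \<odot>\<^bsub>M\<^esub> c"
    if "u \<in> carrier S" "s \<in> carrier S" for u s
    using that ec cc e_mult[OF that] by (simp add: M.eq_diff_iff)
  \<comment> \<open>In terms of \<open>d\<close> the right side is
    \<open>u s c + (u (d s) - s (d u))\<close>: the contributions of \<open>c\<close> to the bracket
    cancel.\<close>
  have B_eq: "B s u = u \<odot>\<^bsub>M\<^esub> e s \<oplus>\<^bsub>M\<^esub> (u \<otimes>\<^bsub>S\<^esub> s) \<odot>\<^bsub>M\<^esub> c \<ominus>\<^bsub>M\<^esub> s \<odot>\<^bsub>M\<^esub> e u"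
    if us: "u \<in> carrier S" "s \<in> carrier S" for u s
  proof -
    have "B s u = u \<odot>\<^bsub>M\<^esub> e s \<oplus>\<^bsub>M\<^esub> u \<odot>\<^bsub>M\<^esub> e s \<ominus>\<^bsub>M\<^esub> e (u \<otimes>\<^bsub>S\<^esub> s)"
      using us ec Bc B_e[OF us] by (simp add: M.eq_diff_iff M.a_comm)
    then show ?thesis
      using us ec cc by (simp add: e_mult' M.module_algebra_simps)
  qed
  have d: "d \<in> carrier (Der R S \<phi> M)"
  proof -
    have "e (s \<oplus>\<^bsub>S\<^esub> t) = e s \<oplus>\<^bsub>M\<^esub> e t" if "s \<in> carrier S" "t \<in> carrier S" for s t
      using that by (simp add: e_def B_add1)
    moreover have "e (\<phi> r \<otimes>\<^bsub>S\<^esub> s) = \<phi> r \<odot>\<^bsub>M\<^esub> e s" if "r \<in> carrier R" "s \<in> carrier S" for r s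
      using that by (simp add: e_def B_lin)
    moreover have "d \<in> carrier S \<rightarrow>\<^sub>E carrier M"
      using ec cc by (simp add: d_def)
    ultimately show ?thesis
      using ec cc by (simp add: Der_iff d_def M.module_algebra_simps) (simp add: e_mult' M.module_algebra_simps)
  qed
  let ?h = "\<lambda>(s, t)\<in>carrier ?P. (s \<otimes>\<^bsub>S\<^esub> s) \<odot>\<^bsub>M\<^esub> q (\<one>\<^bsub>S\<^esub>, \<zero>\<^bsub>S\<^esub>) \<oplus>\<^bsub>M\<^esub>
    (t \<otimes>\<^bsub>S\<^esub> t) \<odot>\<^bsub>M\<^esub> q (\<zero>\<^bsub>S\<^esub>, \<one>\<^bsub>S\<^esub>) \<oplus>\<^bsub>M\<^esub> (s \<otimes>\<^bsub>S\<^esub> t) \<odot>\<^bsub>M\<^esub> c"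
  have decomp: "q (s, t) = ?h (s, t) \<oplus>\<^bsub>M\<^esub> der_quad S M d (s, t)"
    if st: "s \<in> carrier S" "t \<in> carrier S" for s t
  proof -
    have "q (s, t) = B s t \<oplus>\<^bsub>M\<^esub> q (s, \<zero>\<^bsub>S\<^esub>) \<oplus>\<^bsub>M\<^esub> q (\<zero>\<^bsub>S\<^esub>, t)"
      using st qc by (simp add: B M.module_algebra_simps)
    also have "\<dots> = B s t \<oplus>\<^bsub>M\<^esub> (s \<otimes>\<^bsub>S\<^esub> s) \<odot>\<^bsub>M\<^esub> q (\<one>\<^bsub>S\<^esub>, \<zero>\<^bsub>S\<^esub>) \<oplus>\<^bsub>M\<^esub> (t \<otimes>\<^bsub>S\<^esub> t) \<odot>\<^bsub>M\<^esub> q (\<zero>\<^bsub>S\<^esub>, \<one>\<^bsub>S\<^esub>)"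
      \<comment> \<open>On each axis \<open>q\<close> is determined by homogeneity, as
        \<open>(s, 0) = s (1, 0)\<close> and \<open>(0, t) = t (0, 1)\<close>.\<close>
      using st qs[of s "\<one>\<^bsub>S\<^esub>" "\<zero>\<^bsub>S\<^esub>"] qs[of t "\<zero>\<^bsub>S\<^esub>" "\<one>\<^bsub>S\<^esub>"] by simp
    finally have eq: "q (s, t) = \<dots>" .
    show ?thesis
      using st qc ec cc by (subst eq) (simp add: B_eq der_quad_def d_def M.module_algebra_simps)
  qed
  have "q = ?h \<oplus>\<^bsub>Quad R S \<phi> ?P M\<^esub> der_quad S M d"
  proof (intro extensionalityI[of q "carrier ?P"])
    show "q \<in> extensional (carrier ?P)"
      using Q by (simp only: PiE_iff)
    fix x assume "x \<in> carrier ?P"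
    then obtain s t where "x = (s, t)" "s \<in> carrier S" "t \<in> carrier S" by auto
    then show "q x = (?h \<oplus>\<^bsub>Quad R S \<phi> ?P M\<^esub> der_quad S M d) x"
      using decomp[of s t] by simp
  qed simp
  moreover have "?h \<in> carrier (Quad S S id ?P M)"
    by (rule binary_form_in_Quad) (simp_all add: qc cc)
  ultimately show ?thesis using d by blast
qed

end

section \<open>The isomorphism from the direct sum\<close>

lemma mod_hom_direct_sum:
  assumes f: "mod_hom R A N f" and g: "mod_hom R B N g"
  shows "mod_hom R (direct_sum A B) N (\<lambda>(a, b). f a \<oplus>\<^bsub>N\<^esub> g b)"
proof -
  interpret f: mod_hom R A N f by fact
  interpret g: mod_hom R B N g by fact
  show ?thesis
    by (intro mod_hom.intro mod_hom_axioms.intro direct_sum_is_module f.M.module_axioms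
        g.M.module_axioms f.N.module_axioms)
      (auto simp: module_hom_def direct_sum_def f.N.smult_r_distr f.N.M.a_ac)
qed

theorem corollary3p2:
  fixes R :: "('r, 'k) ring_scheme" and S :: "('s, 'l) ring_scheme" and \<phi> :: "'r \<Rightarrow> 's"
    and M :: "('s, 'a, 'm) module_scheme"
  assumes "cring R" and "cring S" and "\<phi> \<in> ring_hom R S"
    and "\<one>\<^bsub>S\<^esub> \<oplus>\<^bsub>S\<^esub> \<one>\<^bsub>S\<^esub> \<in> Units S"
    and "module S M"
  shows "mod_hom S (Der R S \<phi> M) (Quad R S \<phi> (module_square S) M) (der_quad S M)
    \<and> mod_hom S (Quad S S id (module_square S) M) (Quad R S \<phi> (module_square S) M) (\<lambda>q. q)
    \<and> mod_hom S (direct_sum (Quad S S id (module_square S) M) (Der R S \<phi> M))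
           (Quad R S \<phi> (module_square S) M)
           (\<lambda>(q, d). q \<oplus>\<^bsub>Quad R S \<phi> (module_square S) M\<^esub> der_quad S M d)
    \<and> bij_betw (\<lambda>(q, d). q \<oplus>\<^bsub>Quad R S \<phi> (module_square S) M\<^esub> der_quad S M d)
           (carrier (direct_sum (Quad S S id (module_square S) M) (Der R S \<phi> M)))
           (carrier (Quad R S \<phi> (module_square S) M))"
proof -
  interpret module_over_hom R S \<phi> M
    using assms by (intro module_over_hom.intro ring_hom_cring.intro ring_hom_cring_axioms.intro)
  let ?P = "module_square S"
  let ?Q = "Quad R S \<phi> ?P M" and ?K = "Quad S S id ?P M" and ?D = "Der R S \<phi> M"
  let ?F = "\<lambda>(q, d). q \<oplus>\<^bsub>?Q\<^esub> der_quad S M d"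
  have P: "module S ?P" by (rule module_module_square[OF assms(2)])
  have sum: "mod_hom S (direct_sum ?K ?D) ?Q ?F"
    by (rule mod_hom_direct_sum[OF mod_hom_Quad_inclusion[OF P] mod_hom_der_quad])
  interpret K: module S ?K by (rule module_over_hom.module_Quad[OF module_over_hom_id P])
  interpret Q: module S ?Q by (rule module_Quad[OF P])
  interpret D: mod_hom S ?D ?Q "der_quad S M" by (rule mod_hom_der_quad)
  interpret F: mod_hom S "direct_sum ?K ?D" ?Q ?F by (rule sum)
  have ops: "\<zero>\<^bsub>?K\<^esub> = \<zero>\<^bsub>?Q\<^esub>" "\<zero>\<^bsub>?D\<^esub> = (\<lambda>s\<in>carrier S. \<zero>\<^bsub>M\<^esub>)"
    by (simp_all add: Quad_def Der_def fun_module_def)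
  have dsum: "carrier (direct_sum ?K ?D) = carrier ?K \<times> carrier ?D" "\<zero>\<^bsub>direct_sum ?K ?D\<^esub> = (\<zero>\<^bsub>?K\<^esub>, \<zero>\<^bsub>?D\<^esub>)"
    by (simp_all add: direct_sum_def)
  \<comment> \<open>If \<open>q\<close> and \<open>der_quad S M d\<close> sum to zero, then
    \<open>der_quad S M d\<close> is the negative of \<open>q\<close> and so lies in
    \<open>?K\<close>. This forces \<open>d\<close> to vanish, and then \<open>q\<close> vanishes
    too.\<close>
  have ker: "x = \<zero>\<^bsub>direct_sum ?K ?D\<^esub>" if x: "x \<in> carrier (direct_sum ?K ?D)" "?F x = \<zero>\<^bsub>?Q\<^esub>" for x
  proof -
    obtain q d where qd: "x = (q, d)" "q \<in> carrier ?K" "d \<in> carrier ?D"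
      using x(1) unfolding dsum by blast
    have qQ: "q \<in> carrier ?Q" using qd Quad_id_subset[OF P] by blast
    have dQ: "der_quad S M d \<in> carrier ?Q" by (rule der_quad_in_Quad[OF qd(3)])
    have F0: "q \<oplus>\<^bsub>?Q\<^esub> der_quad S M d = \<zero>\<^bsub>?Q\<^esub>"
      using x(2) unfolding qd(1) by (simp only: prod.case)
    have "der_quad S M d = \<ominus>\<^bsub>?Q\<^esub> q"
      using F0 by (intro Q.M.minus_equality[symmetric] qQ dQ) (simp only: Q.M.a_comm[OF dQ qQ])
    \<comment> \<open>The additive inverse is defined through the carrier, so negation in
      \<open>?Q\<close> is not literally negation in \<open>?K\<close>. Scalar multiplication is the
      same function in both, and multiplying by \<open>-1\<close> leads from one to the
      other.\<close>
    also have "\<dots> = (\<ominus>\<^bsub>S\<^esub> \<one>\<^bsub>S\<^esub>) \<odot>\<^bsub>?K\<^esub> q"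
      by (simp only: Q.smult_minus_1[OF qQ, symmetric] Quad_ops)
    also have "\<dots> \<in> carrier ?K"
      by (intro K.smult_closed S.a_inv_closed S.one_closed qd)
    finally have d0: "d = \<zero>\<^bsub>?D\<^esub>"
      unfolding ops by (rule der_quad_in_Quad_id[OF qd(3)])
    then have "q = \<zero>\<^bsub>?Q\<^esub>"
      using F0 by (simp only: D.f0_is_0 Q.M.r_zero qQ)
    then show ?thesis by (simp only: qd(1) d0 ops(1) dsum)
  qed
  have "inj_on ?F (carrier (direct_sum ?K ?D))"
  proof (rule inj_onI)
    fix x y assume xy: "x \<in> carrier (direct_sum ?K ?D)" "y \<in> carrier (direct_sum ?K ?D)" "?F x = ?F y"
    \<comment> \<open>Injectivity follows from the trivial kernel, applied to the difference of
      \<open>x\<close> and \<open>y\<close>.\<close>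
    then have "?F (x \<ominus>\<^bsub>direct_sum ?K ?D\<^esub> y) = \<zero>\<^bsub>?Q\<^esub>"
      by (simp only: F.f_minus Q.M.minus_other_side F.f_im)
    then have "x \<ominus>\<^bsub>direct_sum ?K ?D\<^esub> y = \<zero>\<^bsub>direct_sum ?K ?D\<^esub>"
      by (intro ker F.M.M.minus_closed xy)
    then show "x = y"
      using xy by (simp only: F.M.M.minus_other_side)
  qed
  moreover have "?F ` carrier (direct_sum ?K ?D) = carrier ?Q"
  proof
    show "?F ` carrier (direct_sum ?K ?D) \<subseteq> carrier ?Q"
      using F.f_im by blast
    show "carrier ?Q \<subseteq> ?F ` carrier (direct_sum ?K ?D)"
    proof
      fix q assume "q \<in> carrier ?Q"
      from Quad_decomposition[OF assms(4) this] obtain h d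
        where hd: "h \<in> carrier ?K" "d \<in> carrier ?D" "q = ?F (h, d)" unfolding prod.case by blast
      then show "q \<in> ?F ` carrier (direct_sum ?K ?D)"
        by (intro image_eqI[of _ _ "(h, d)"]) (simp_all only: dsum mem_Times_iff fst_conv snd_conv)
    qed
  qed
  ultimately show ?thesis
    unfolding bij_betw_def by (intro conjI sum mod_hom_der_quad mod_hom_Quad_inclusion P)
qed

end
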